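(* Let $X$ be a topological space. Then $X$ is DRC$_\omega$ if and only if $P\uparrow_{1,n}Sp(X)$. Let $Y$ be a topological space. Then $Y$ is DRS$_\omega$ if and only if $P\uparrow_{1,n}Ssp(Y)$.
   Context: For a space $X$, a point $x\in X$ is an accumulation point of a sequence $\langle a_n:n\in\omega\rangle$ of points of $X$ if $\{n\in\omega:a_n\in U\}$ is infinite for each open $U\ni x$. $X$ is DRC$_\omega$ if there is a sequence $\langle D_n:n\in\omega\rangle$ of dense subsets of $X$ such that every sequence $\langle d_n:n\in\omega\rangle$ with $d_n\in D_n$ for all $n$ has an accumulation point in $X$. $X$ is DRS$_\omega$ if there is a sequence $\langle D_n:n\in\omega\rangle$ of dense subsets of $X$ such that every sequence $\langle d_n:n\in\omega\rangle$ with $d_n\in D_n$ for all $n$ contains a subsequence converging to a point of $X$. The games $Sp(X)$ and $Ssp(X)$ between players O and P are played in $\omega$ turns. In both games, in the $n$th turn O picks a non-empty open set $U_n$, and then P picks a point $x_n\in U_n$. In $Sp(X)$ player P wins iff $\langle x_n:n\in\omega\rangle$ has an accumulation point in $X$. In $Ssp(X)$ player P wins iff $\langle x_n:n\in\omega\rangle$ contains a convergent subsequence. $P\uparrow_{1,n}Sp(X)$ means that P has a winning strategy in $Sp(X)$ in which the $n$th move of P depends only on $n$ and $U_n$, i.e. there is a function $\sigma:\omega\times\tau_X^+\to X$ (with $\tau_X^+$ the family of non-empty open subsets of $X$) with $\sigma(n,U)\in U$ such that P wins every play in which P always answers $x_n=\sigma(n,U_n)$. $P\uparrow_{1,n}Ssp(X)$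 is defined similarly for $Ssp(X)$. *)

theory Defs
  imports "HOL-Analysis.Analysis"
begin

definition accumulation_point_of_seq :: "'a topology \<Rightarrow> (nat \<Rightarrow> 'a) \<Rightarrow> 'a \<Rightarrow> bool" where
  "accumulation_point_of_seq X a x \<longleftrightarrow>
     x \<in> topspace X \<and> (\<forall>U. openin X U \<and> x \<in> U \<longrightarrow> infinite {n. a n \<in> U})"

definition has_convergent_subseq :: "'a topology \<Rightarrow> (nat \<Rightarrow> 'a) \<Rightarrow> bool" where
  "has_convergent_subseq X a \<longleftrightarrow>
     (\<exists>r l. strict_mono r \<and> limitin X (a \<circ> r) l sequentially)"

definition dense_subset :: "'a topology \<Rightarrow> 'a set \<Rightarrow> bool" where
  "dense_subset X D \<longleftrightarrow> D \<subseteq> topspace X \<and> X closure_of D = topspace X"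

definition DRC_omega :: "'a topology \<Rightarrow> bool" where
  "DRC_omega X \<longleftrightarrow>
     (\<exists>D :: nat \<Rightarrow> 'a set. (\<forall>n. dense_subset X (D n)) \<and>
        (\<forall>d. (\<forall>n. d n \<in> D n) \<longrightarrow> (\<exists>x. accumulation_point_of_seq X d x)))"

definition DRS_omega :: "'a topology \<Rightarrow> bool" where
  "DRS_omega X \<longleftrightarrow>
     (\<exists>D :: nat \<Rightarrow> 'a set. (\<forall>n. dense_subset X (D n)) \<and>
        (\<forall>d. (\<forall>n. d n \<in> D n) \<longrightarrow> has_convergent_subseq X d))"

(* The games Sp(X) and Ssp(X) have the same plays and differ only in the winning condition for P,
   which depends only on the sequence of points picked by P. Here U and x are the sequences of
   moves of O and of P, respectively. *)
definition game_play :: "'a topology \<Rightarrow> (nat \<Rightarrow> 'a set) \<Rightarrow> (nat \<Rightarrow> 'a) \<Rightarrow> bool" where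
  "game_play X U x \<longleftrightarrow> (\<forall>n. openin X (U n) \<and> U n \<noteq> {} \<and> x n \<in> U n)"

definition Sp_won_by_P :: "'a topology \<Rightarrow> (nat \<Rightarrow> 'a) \<Rightarrow> bool" where
  "Sp_won_by_P X x \<longleftrightarrow> (\<exists>p. accumulation_point_of_seq X x p)"

definition Ssp_won_by_P :: "'a topology \<Rightarrow> (nat \<Rightarrow> 'a) \<Rightarrow> bool" where
  "Ssp_won_by_P X x \<longleftrightarrow> has_convergent_subseq X x"

(* P has a winning strategy whose n-th move depends only on n and U n, in the game on X with
   winning condition W. Values of the total function \<sigma> at sets that are not non-empty and open
   are irrelevant. *)
definition P_wins_1n :: "'a topology \<Rightarrow> ((nat \<Rightarrow> 'a) \<Rightarrow> bool) \<Rightarrow> bool" where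
  "P_wins_1n X W \<longleftrightarrow>
     (\<exists>\<sigma> :: nat \<Rightarrow> 'a set \<Rightarrow> 'a.
        (\<forall>n U. openin X U \<and> U \<noteq> {} \<longrightarrow> \<sigma> n U \<in> U) \<and>
        (\<forall>U x. game_play X U x \<and> (\<forall>n. x n = \<sigma> n (U n)) \<longrightarrow> W x))"

definition P_wins_1n_Sp :: "'a topology \<Rightarrow> bool" where
  "P_wins_1n_Sp X \<longleftrightarrow> P_wins_1n X (Sp_won_by_P X)"

definition P_wins_1n_Ssp :: "'a topology \<Rightarrow> bool" where
  "P_wins_1n_Ssp X \<longleftrightarrow> P_wins_1n X (Ssp_won_by_P X)"

end

theory Submission
  imports Defs
begin

text \<open>Non-empty open sets are the legal moves of O, so in this form density says that P can
  answer every move with a point of \<open>D\<close>.\<close>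

lemma dense_subset_iff:
  "dense_subset X D \<longleftrightarrow> D \<subseteq> topspace X \<and> (\<forall>U. openin X U \<and> U \<noteq> {} \<longrightarrow> U \<inter> D \<noteq> {})"
  unfolding dense_subset_def dense_intersects_open by (metis Int_commute)

text \<open>The dense sets correspond to the ranges of the strategy on the non-empty open sets:
  a strategy picks points from given dense sets, and conversely a selection from the ranges is
  the sequence of answers of P in some play.\<close>

lemma P_wins_1n_iff_dense_selection:
  "P_wins_1n X W \<longleftrightarrow>
     (\<exists>D :: nat \<Rightarrow> 'a set. (\<forall>n. dense_subset X (D n)) \<and> (\<forall>d. (\<forall>n. d n \<in> D n) \<longrightarrow> W d))"
proof
  assume "P_wins_1n X W"
  then obtain \<sigma> :: "nat \<Rightarrow> 'a set \<Rightarrow> 'a"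
    where \<sigma>: "\<forall>n U. openin X U \<and> U \<noteq> {} \<longrightarrow> \<sigma> n U \<in> U"
      and win: "\<forall>U x. game_play X U x \<and> (\<forall>n. x n = \<sigma> n (U n)) \<longrightarrow> W x"
    unfolding P_wins_1n_def by (elim exE conjE)
  define D where "D n = \<sigma> n ` {U. openin X U \<and> U \<noteq> {}}" for n
  have "dense_subset X (D n)" for n
    unfolding dense_subset_iff
  proof (intro conjI allI impI)
    show "D n \<subseteq> topspace X"
      unfolding D_def using \<sigma> openin_subset by blast
    show "U \<inter> D n \<noteq> {}" if "openin X U \<and> U \<noteq> {}" for U
    proof -
      have "\<sigma> n U \<in> U \<inter> D n"
        unfolding D_def using that \<sigma> by blast
      then show ?thesis by blast
    qed
  qed
  moreover have "\<forall>d. (\<forall>n. d n \<in> D n) \<longrightarrow> W d"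
  proof (intro allI impI)
    fix d assume d: "\<forall>n. d n \<in> D n"
    \<comment> \<open>A move of O can be chosen for each \<open>n\<close> separately because the
      answer of P depends only on \<open>n\<close> and that move: no earlier moves have to be
      matched.\<close>
    have "\<forall>n. \<exists>U. openin X U \<and> U \<noteq> {} \<and> d n = \<sigma> n U"
      using d unfolding D_def by blast
    then obtain U where U: "\<forall>n. openin X (U n) \<and> U n \<noteq> {} \<and> d n = \<sigma> n (U n)"
      by metis
    then have "game_play X U d"
      unfolding game_play_def using \<sigma> by metis
    with U win show "W d"
      by blast
  qed
  ultimately show "\<exists>D. (\<forall>n. dense_subset X (D n)) \<and> (\<forall>d. (\<forall>n. d n \<in> D n) \<longrightarrow> W d)"
    by (intro exI[of _ D] conjI allI) simp_all
next
  assume "\<exists>D :: nat \<Rightarrow> 'a set.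
    (\<forall>n. dense_subset X (D n)) \<and> (\<forall>d. (\<forall>n. d n \<in> D n) \<longrightarrow> W d)"
  then obtain D :: "nat \<Rightarrow> 'a set"
    where dense: "\<forall>n. dense_subset X (D n)" and win: "\<forall>d. (\<forall>n. d n \<in> D n) \<longrightarrow> W d"
    by (elim exE conjE)
  \<comment> \<open>Density makes the intersection non-empty for every legal \<open>U\<close>, and
    the choice looks only at \<open>n\<close> and \<open>U\<close>, as the strategy must.\<close>
  define \<sigma> where "\<sigma> n U = (SOME x. x \<in> U \<inter> D n)" for n U
  have \<sigma>: "\<sigma> n U \<in> U \<inter> D n" if "openin X U" "U \<noteq> {}" for n U
    unfolding \<sigma>_def some_in_eq using dense that by (simp add: dense_subset_iff)
  show "P_wins_1n X W"
    unfolding P_wins_1n_def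
  proof (intro exI[of _ \<sigma>] conjI allI impI)
    show "\<sigma> n U \<in> U" if "openin X U \<and> U \<noteq> {}" for n U
      using \<sigma> that by blast
    fix U x assume "game_play X U x \<and> (\<forall>n. x n = \<sigma> n (U n))"
    then have "\<forall>n. x n \<in> D n"
      using \<sigma> unfolding game_play_def by (metis IntD2)
    with win show "W x"
      by blast
  qed
qed

theorem proposition1p2:
  fixes X :: "'a topology" and Y :: "'b topology"
  shows "(DRC_omega X \<longleftrightarrow> P_wins_1n_Sp X) \<and> (DRS_omega Y \<longleftrightarrow> P_wins_1n_Ssp Y)"
  \<comment> \<open>Since \<open>W\<close> is arbitrary in
    \<open>P_wins_1n_iff_dense_selection\<close>, its instances for the two winning conditions
    settle both games.\<close>
  unfolding DRC_omega_def DRS_omega_def P_wins_1n_Sp_def P_wins_1n_Ssp_def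
    P_wins_1n_iff_dense_selection Sp_won_by_P_def Ssp_won_by_P_def
  by simp

end
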